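(* Let $G$ be a minimally $1$-tough graph on $n$ vertices. Then $G$ has a vertex of degree at most $\frac{n}{3}+1$.
   Context: All graphs are finite, simple and undirected. For a graph $G$, $\omega(G)$ denotes the number of connected components of $G$. A cutset of $G$ is a set $S\subseteq V(G)$ such that $G-S$ is disconnected, i.e. $\omega(G-S)\ge 2$. For a positive real number $t$, a graph $G$ is called $t$-tough if $\omega(G-S)\le |S|/t$ for every cutset $S$ of $G$. The toughness $\tau(G)$ is the largest $t$ for which $G$ is $t$-tough, with $\tau(K_n)=\infty$ for all $n\ge 1$ (and $\tau(G)=0$ if $G$ is disconnected). A graph $G$ is minimally $t$-tough if $\tau(G)=t$ and $\tau(G-e)<t$ for every $e\in E(G)$. *)

theory Defs
  imports
    "HOL-Library.Extended_Real"
    "Graph_Theory.Graph_Theory"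
begin

text \<open>
  A finite simple undirected graph is a \<^locale>\<open>pair_graph\<close>: an edge \<open>uv\<close> is represented by the two
  arcs \<open>(u, v)\<close> and \<open>(v, u)\<close>. Since the arc relation is symmetric, strongly connected components
  are connected components (they are nonempty by definition, so the graph without vertices has none),
  and the out-degree of a vertex is its degree.
\<close>

definition num_components :: "('a, 'b) pre_digraph \<Rightarrow> nat" where
  "num_components H = card (pre_digraph.sccs H)"

definition del_verts :: "'a pair_pre_digraph \<Rightarrow> 'a set \<Rightarrow> ('a, 'a \<times> 'a) pre_digraph" where
  "del_verts G S = with_proj G \<restriction> (pverts G - S)"

definition del_edge :: "'a pair_pre_digraph \<Rightarrow> 'a \<times> 'a \<Rightarrow> 'a pair_pre_digraph" where
  "del_edge G e = G\<lparr>parcs := parcs G - {(fst e, snd e), (snd e, fst e)}\<rparr>"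

definition cutset :: "'a pair_pre_digraph \<Rightarrow> 'a set \<Rightarrow> bool" where
  "cutset G S \<longleftrightarrow> S \<subseteq> pverts G \<and> num_components (del_verts G S) \<ge> 2"

definition tough :: "real \<Rightarrow> 'a pair_pre_digraph \<Rightarrow> bool" where
  "tough t G \<longleftrightarrow> 0 < t \<and>
     (\<forall>S. cutset G S \<longrightarrow> real (num_components (del_verts G S)) \<le> real (card S) / t)"

text \<open>
  In the last case the graph is connected and not complete, so it has a cutset, every cutset is
  nonempty, and the largest \<open>t\<close> exists. The first case also covers the graph without vertices,
  for which there is no largest \<open>t\<close> either.
\<close>

definition toughness :: "'a pair_pre_digraph \<Rightarrow> ereal" where
  "toughness G =
     (if \<exists>n. complete_digraph n (with_proj G) then \<infinity>
      else if num_components (with_proj G) \<ge> 2 then 0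
      else ereal (GREATEST t. tough t G))"

definition minimally_tough :: "real \<Rightarrow> 'a pair_pre_digraph \<Rightarrow> bool" where
  "minimally_tough t G \<longleftrightarrow> 0 < t \<and> toughness G = ereal t \<and>
     (\<forall>e \<in> parcs G. toughness (del_edge G e) < ereal t)"

end

theory Submission
  imports Defs
begin

text \<open>
  Let \<open>G\<close> be minimally 1-tough with \<open>n\<close> vertices. Deleting an edge \<open>xy\<close> must create a set \<open>S\<close> with
  more than \<open>|S|\<close> components in \<open>G - xy - S\<close>. As \<open>G\<close> itself is 1-tough, \<open>xy\<close> joins two of these
  components, so \<open>xy\<close> is a bridge of \<open>G - S\<close> (\<open>minimally_1_tough_splits\<close>). What remains is counting.
  Components are handled as the classes of a labelling \<open>c\<close> of \<open>V - S\<close> that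
  only the edge \<open>xy\<close> may violate; the number of components is the largest number of labels that a
  labelling constant along the edges can have.

  Suppose now that all degrees are at least \<open>\<delta>\<close>, where \<open>3\<delta> \<ge> n + 4\<close>, and let \<open>S\<close> belong to an edge \<open>xy\<close>.

  \<^item> Either \<open>|S| \<le> 1\<close> or \<open>|S| \<ge> \<delta>\<close>. Each of the \<open>|S| + 1\<close> or more components has about
    \<open>\<delta> - |S| + 1\<close> vertices, as a vertex has all its neighbours in \<open>S\<close> and its own component, and for
    sizes in between this exceeds \<open>n\<close> (\<open>splits_small_or_large\<close>).
  \<^item> \<open>|N(x) \<union> N(y)| \<le> n + 1 - |S|\<close>, because this union avoids the components that contain neither
    \<open>x\<close> nor \<open>y\<close>, and there are at least \<open>|S| - 1\<close> of those (\<open>splits_card_nbh_union\<close>).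

  If every edge has a set with at least \<open>\<delta>\<close> elements, then \<open>|N(x) \<union> N(y)| \<le> n + 1 - \<delta> < 2\<delta>\<close> for all
  edges. But counting the edges between one such \<open>S\<close> and one representative of each component of
  \<open>G - S\<close> gives an \<open>x\<close> in \<open>S\<close> with \<open>\<delta>\<close> neighbours among the representatives, one of which, \<open>y\<close>, is a
  component on its own; then \<open>N(y)\<close> lies in \<open>S\<close> and the union has at least \<open>2\<delta>\<close> elements
  (\<open>dense_edge_of_tight_set\<close>).

  Otherwise some edge joins two sides \<open>A\<close> and \<open>B\<close> that are separated, up to this edge, by at most
  one vertex. Both sides are so dense that independent sets have fewer than \<open>\<delta>\<close> elements. A set
  \<open>S\<close> with at least \<open>\<delta>\<close> elements would provide an independent set as large as itself,
  hence no edge has one, and all have \<open>|S| \<le> 1\<close>. Since the common neighbours of the ends of a bridge of \<open>G - S\<close> lie in \<open>S\<close>,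
  adjacent vertices have at most one common neighbour. This fails for two adjacent vertices of
  the smaller side (\<open>side_edge_with_common_nbhs\<close>).
\<close>

section \<open>Components as labellings\<close>

lemma verts_del_verts [simp]: "verts (del_verts G S) = pverts G - S"
  by (simp add: del_verts_def)

lemma arcs_ends_del_verts:
  "arcs_ends (del_verts G S) = {(u, v) \<in> parcs G. u \<in> pverts G - S \<and> v \<in> pverts G - S}"
  by (force simp: del_verts_def arcs_ends_def arc_to_ends_def induce_subgraph_def with_proj_def)

lemma (in pair_graph) graph_del_verts: "graph (del_verts G S)"
proof -
  have "digraph (del_verts G S)"
    unfolding del_verts_def by (rule digraphI_induced) (rule induced_induce, auto)
  moreover have "symmetric (del_verts G S)"
    unfolding symmetric_def arcs_ends_del_verts by (auto simp: sym_def intro: arcs_symmetric)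
  ultimately show ?thesis
    by (simp add: graph_def pseudo_graph_def sym_digraph_def sym_digraph_axioms_def digraph_def fin_digraph_def)
qed

lemma (in pair_graph) num_components_conv:
  "num_components (del_verts G S) = card (pre_digraph.scc_of (del_verts G S) ` (pverts G - S))"
proof -
  interpret H: graph "del_verts G S" by (rule graph_del_verts)
  show ?thesis
    using H.sccs_verts_conv_scc_of H.card_sccs_verts by (simp add: num_components_def)
qed

lemma (in pair_graph) scc_of_adjacent:
  assumes "(u, v) \<in> parcs G" "u \<notin> S" "v \<notin> S"
  shows "pre_digraph.scc_of (del_verts G S) u = pre_digraph.scc_of (del_verts G S) v"
proof -
  interpret H: graph "del_verts G S" by (rule graph_del_verts)
  have "u \<rightarrow>\<^bsub>del_verts G S\<^esub> v"
    using assms by (auto simp: arcs_ends_del_verts dest: wellformed')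
  then show ?thesis
    by (intro H.scc_of_eq H.scc_ofI_reachable) auto
qed

text \<open>
  Such a labelling factors through the components. It gives lower bounds on numbers of components
  without any reasoning about paths.
\<close>

lemma (in pair_graph) card_labels_le_num_components:
  assumes "\<And>u v. (u, v) \<in> parcs G \<Longrightarrow> u \<notin> S \<Longrightarrow> v \<notin> S \<Longrightarrow> c u = c v"
  shows "card (c ` (pverts G - S)) \<le> num_components (del_verts G S)"
proof -
  interpret H: graph "del_verts G S" by (rule graph_del_verts)
  have "c u = c v" if "u \<rightarrow>\<^sup>*\<^bsub>del_verts G S\<^esub> v" for u v
    using that
    by (induction rule: H.reachable_induct) (auto simp: arcs_ends_del_verts dest: assms)
  then have const: "c u = c v" if "H.scc_of u = H.scc_of v" "u \<in> pverts G - S" for u v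
    using that H.in_scc_of_self[of u] by (auto simp: H.scc_of_def)
  have "card (c ` (pverts G - S)) \<le> card (H.scc_of ` (pverts G - S))"
  proof (rule surj_card_le[where f = "\<lambda>D. c (SOME v. v \<in> pverts G - S \<and> H.scc_of v = D)"])
    show "c ` (pverts G - S) \<subseteq>
      (\<lambda>D. c (SOME v. v \<in> pverts G - S \<and> H.scc_of v = D)) ` H.scc_of ` (pverts G - S)"
    proof (rule image_subsetI)
      fix u assume u: "u \<in> pverts G - S"
      let ?w = "SOME v. v \<in> pverts G - S \<and> H.scc_of v = H.scc_of u"
      have "?w \<in> pverts G - S \<and> H.scc_of ?w = H.scc_of u"
        by (rule someI[where x = u]) (use u in auto)
      then have "c u = c ?w" using const u by metis
      then show "c u \<in> (\<lambda>D. c (SOME v. v \<in> pverts G - S \<and> H.scc_of v = D)) ` H.scc_of ` (pverts G - S)"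
        using u by blast
    qed
  qed (simp add: pair_finite_verts)
  then show ?thesis by (simp add: num_components_conv)
qed

section \<open>The edges of a minimally tough graph are bridges of critical subgraphs\<close>

lemma (in pair_graph) del_verts_empty: "del_verts G {} = with_proj G"
  by (auto simp: del_verts_def induce_subgraph_def with_proj_def dest: arc_fst_in_verts arc_snd_in_verts)

text \<open>The two vertices left by the cutset are nonadjacent, so the identity is a labelling.\<close>

lemma (in pair_graph) cutset_if_not_complete:
  assumes "\<nexists>n. complete_digraph n (with_proj G)"
  shows "\<exists>S. cutset G S"
proof -
  have "parcs G \<noteq> {(u, v). (u, v) \<in> pverts G \<times> pverts G \<and> u \<noteq> v}"
    using assms pair_graphD_graph by (auto simp: complete_digraph_def)
  then obtain u v where uv: "u \<in> pverts G" "v \<in> pverts G" "u \<noteq> v" "(u, v) \<notin> parcs G"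
    by (auto dest: wellformed' no_loops')
  define S where "S = pverts G - {u, v}"
  have "card (id ` (pverts G - S)) \<le> num_components (del_verts G S)"
    by (rule card_labels_le_num_components)
      (use uv in \<open>auto simp: S_def dest: wellformed' no_loops' arcs_symmetric\<close>)
  moreover have "pverts G - S = {u, v}" using uv by (auto simp: S_def)
  ultimately have "cutset G S" using uv by (auto simp: cutset_def S_def)
  then show ?thesis ..
qed

text \<open>
  The toughness is a minimum over the finitely many cutsets, so the \<open>GREATEST\<close> in its definition
  exists. For a disconnected graph the minimum is \<open>0\<close>, attained by the empty cutset; this makes
  the formula cover both cases.
\<close>

lemma (in pair_graph) toughness_attained:
  assumes "\<nexists>n. complete_digraph n (with_proj G)"
  defines "q \<equiv> \<lambda>S. real (card S) / real (num_components (del_verts G S))"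
  obtains S where "cutset G S" "toughness G = ereal (q S)" "\<And>S'. cutset G S' \<Longrightarrow> q S \<le> q S'"
proof (cases "num_components (with_proj G) \<ge> 2")
  case True
  then have "cutset G {}" by (simp add: cutset_def del_verts_empty)
  moreover have "toughness G = ereal (q {})" using True assms by (simp add: toughness_def)
  moreover have "q {} \<le> q S'" for S' by (simp add: q_def)
  ultimately show ?thesis using that by blast
next
  case False
  let ?C = "Collect (cutset G)"
  have "?C \<subseteq> Pow (pverts G)" by (auto simp: cutset_def)
  then have fin: "finite ?C" by (rule finite_subset) (simp add: pair_finite_verts)
  have ne: "?C \<noteq> {}" using cutset_if_not_complete[OF assms(1)] by auto
  have "Min (q ` ?C) \<in> q ` ?C" using fin ne by (intro Min_in) auto
  then obtain S where S: "cutset G S" "Min (q ` ?C) = q S" by auto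
  have le: "q S \<le> q S'" if "cutset G S'" for S'
    using that fin S(2) Min_le[of "q ` ?C" "q S'"] by simp
  have pos: "q S' > 0" if "cutset G S'" for S'
  proof -
    have "S' \<noteq> {}" using that False by (auto simp: cutset_def del_verts_empty)
    moreover have "finite S'" using that pair_finite_verts by (auto simp: cutset_def intro: finite_subset)
    ultimately have "card S' > 0" by (simp add: card_gt_0_iff)
    then show ?thesis using that by (auto simp: q_def cutset_def)
  qed
  have tough_iff: "tough t G \<longleftrightarrow> 0 < t \<and> (\<forall>S'. cutset G S' \<longrightarrow> t \<le> q S')" for t
  proof -
    have "real (num_components (del_verts G S')) \<le> real (card S') / t \<longleftrightarrow> t \<le> q S'"
      if "0 < t" "cutset G S'" for S'
      using that by (simp add: q_def cutset_def field_simps)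
    then show ?thesis unfolding tough_def by blast
  qed
  have "(GREATEST t. tough t G) = q S"
    by (rule Greatest_equality) (use S le pos in \<open>auto simp: tough_iff\<close>)
  then have "toughness G = ereal (q S)" using False assms by (simp add: toughness_def)
  then show ?thesis using that S(1) le by blast
qed

text \<open>
  The labels are the components of \<open>G - xy - S\<close> or unions of them, and there are more labels than
  elements of \<open>S\<close>. The ends \<open>x\<close> and \<open>y\<close> have different labels, which makes \<open>xy\<close> a bridge of
  \<open>G - S\<close>.
\<close>

definition splits :: "'a pair_pre_digraph \<Rightarrow> 'a \<Rightarrow> 'a \<Rightarrow> 'a set \<Rightarrow> ('a \<Rightarrow> 'b) \<Rightarrow> bool" where
  "splits G x y S c \<longleftrightarrow> S \<subseteq> pverts G \<and> x \<in> pverts G - S \<and> y \<in> pverts G - S \<and> c x \<noteq> c y \<and>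
     (\<forall>u v. (u, v) \<in> parcs G \<longrightarrow> u \<notin> S \<longrightarrow> v \<notin> S \<longrightarrow> c u = c v \<or> {u, v} = {x, y}) \<and>
     card S < card (c ` (pverts G - S))"

lemma (in pair_graph) pair_graph_del_edge: "pair_graph (del_edge G e)"
proof unfold_locales
  show "symmetric (with_proj (del_edge G e))"
    by (auto simp: symmetric_def sym_def del_edge_def intro: arcs_symmetric)
qed (auto simp: del_edge_def pair_finite_verts pair_finite_arcs pair_no_loops
      intro: arc_fst_in_verts arc_snd_in_verts)

text \<open>
  A cutset \<open>S\<close> of \<open>G - xy\<close> that attains a toughness below \<open>1\<close> works: if \<open>xy\<close> did not join two
  components of \<open>G - xy - S\<close>, then \<open>G - S\<close> would have just as many components, and \<open>G\<close> would not be
  1-tough.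
\<close>

lemma (in pair_graph) minimally_1_tough_splits:
  assumes "minimally_tough 1 G" "(x, y) \<in> parcs G"
  shows "\<exists>S (c :: 'a \<Rightarrow> 'a set). splits G x y S c"
proof -
  have tG: "toughness G = ereal 1" and less: "toughness (del_edge G (x, y)) < ereal 1"
    using assms by (auto simp: minimally_tough_def)
  have "\<nexists>n. complete_digraph n (with_proj G)"
    using tG by (metis PInfty_neq_ereal(1) toughness_def)
  then obtain R where "toughness G = ereal (real (card R) / num_components (del_verts G R))"
    and R: "\<And>S'. cutset G S' \<Longrightarrow> real (card R) / num_components (del_verts G R)
        \<le> real (card S') / num_components (del_verts G S')"
    using toughness_attained by metis
  with tG have "1 \<le> real (card S) / num_components (del_verts G S)" if "cutset G S" for S
    using that by (metis ereal.inject)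
  then have G_tough: "num_components (del_verts G S) \<le> card S" if "cutset G S" for S
    using that by (auto simp: cutset_def field_simps)
  interpret H: pair_graph "del_edge G (x, y)" by (rule pair_graph_del_edge)
  have xy: "x \<in> pverts G" "y \<in> pverts G" "x \<noteq> y" using assms(2) by (auto dest: wellformed' no_loops')
  have [simp]: "pverts (del_edge G (x, y)) = pverts G" by (simp add: del_edge_def)
  have "(x, y) \<notin> parcs (del_edge G (x, y))" by (simp add: del_edge_def)
  then have "\<nexists>n. complete_digraph n (with_proj (del_edge G (x, y)))"
    using xy by (auto simp: complete_digraph_def)
  then obtain S where S: "cutset (del_edge G (x, y)) S"
    "toughness (del_edge G (x, y)) = ereal (real (card S) / num_components (del_verts (del_edge G (x, y)) S))"
    using H.toughness_attained by metis
  let ?c = "pre_digraph.scc_of (del_verts (del_edge G (x, y)) S)"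
  have two: "card (?c ` (pverts G - S)) \<ge> 2"
    using S(1) H.num_components_conv[of S] by (simp add: cutset_def)
  have more: "card S < card (?c ` (pverts G - S))"
    using S less H.num_components_conv[of S] by (auto simp: cutset_def field_simps)
  have resp: "?c u = ?c v \<or> {u, v} = {x, y}" if "(u, v) \<in> parcs G" "u \<notin> S" "v \<notin> S" for u v
    using that H.scc_of_adjacent[of u v S] by (auto simp: del_edge_def)
  have "x \<notin> S \<and> y \<notin> S \<and> ?c x \<noteq> ?c y"
  proof (rule ccontr)
    assume neg: "\<not> ?thesis"
    have "?c u = ?c v" if "(u, v) \<in> parcs G" "u \<notin> S" "v \<notin> S" for u v
      using resp[OF that] that neg by (auto simp: doubleton_eq_iff)
    then have le: "card (?c ` (pverts G - S)) \<le> num_components (del_verts G S)"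
      by (rule card_labels_le_num_components)
    then have "cutset G S" using two S(1) by (auto simp: cutset_def)
    then show False using G_tough le more by fastforce
  qed
  then have "splits G x y S ?c"
    using S(1) xy more resp unfolding splits_def by (auto simp: cutset_def)
  then show ?thesis by blast
qed

section \<open>Counting in the parts of a labelling\<close>

definition nbh :: "'a pair_pre_digraph \<Rightarrow> 'a \<Rightarrow> 'a set" where
  "nbh G v = {u. (v, u) \<in> parcs G}"

text \<open>
  Counting over one representative per class, rather than over the labels, lets the degree bound
  be applied to each class.
\<close>

lemma transversal_of_labelling:
  fixes c :: "'a \<Rightarrow> 'b"
  assumes "finite W"
  obtains T where "T \<subseteq> W" "inj_on c T" "card T = card (c ` W)"
    "(\<Sum>t\<in>T. card {u \<in> W. c u = c t}) = card W"
proof -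
  obtain T where T: "T \<subseteq> W" "inj_on c T" "c ` W = c ` T"
    by (metis subset_image_inj order_refl)
  have "finite T" using T assms finite_subset by blast
  have "W = (\<Union>t\<in>T. {u \<in> W. c u = c t})" using T by (auto simp: image_iff set_eq_iff)
  then have "card W = card (\<Union>t\<in>T. {u \<in> W. c u = c t})" by simp
  also have "\<dots> = (\<Sum>t\<in>T. card {u \<in> W. c u = c t})"
    by (rule card_UN_disjoint) (use T assms \<open>finite T\<close> in \<open>auto simp: inj_on_def\<close>)
  finally show ?thesis using that[of T] T by (simp add: card_image)
qed

context pair_graph
begin

lemma finite_verts_subset: "A \<subseteq> pverts G \<Longrightarrow> finite A"
  using pair_finite_verts finite_subset by blast

lemma card_verts_Diff: "S \<subseteq> pverts G \<Longrightarrow> card (pverts G - S) + card S = card (pverts G)"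
  using pair_finite_verts
  by (simp add: card_Diff_subset card_mono finite_verts_subset)

lemma nbh_subset: "nbh G v \<subseteq> pverts G"
  by (auto simp: nbh_def dest: wellformed')

lemma finite_nbh [simp]: "finite (nbh G v)"
  using nbh_subset pair_finite_verts by (rule finite_subset)

lemma nbh_sym: "u \<in> nbh G v \<longleftrightarrow> v \<in> nbh G u"
  by (auto simp: nbh_def intro: arcs_symmetric)

lemma not_in_nbh_self [simp]: "v \<notin> nbh G v"
  by (auto simp: nbh_def dest: no_loops')

lemma sum_card_nbh_swap:
  assumes "finite T" "finite S"
  shows "(\<Sum>t\<in>T. card (nbh G t \<inter> S)) = (\<Sum>x\<in>S. card (nbh G x \<inter> T))"
proof -
  have *: "card (nbh G t \<inter> A) = (\<Sum>x\<in>A. if x \<in> nbh G t then 1 else 0)" if "finite A" for t A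
    using that by (simp add: Int_commute sum.If_cases Int_def)
  show ?thesis
    using assms by (simp add: * sum.swap[of _ T S] nbh_sym cong: if_cong)
qed

text \<open>
  The classes have sizes \<open>|P|\<close> with sum \<open>n - |S|\<close>, and the representative of \<open>P\<close> has at least
  \<open>\<delta> + 1 - |P|\<close> neighbours in \<open>S\<close>. Summed up, this leaves more than \<open>(\<delta> - 1)|S|\<close> edges between \<open>S\<close>
  and the representatives, so some \<open>x \<in> S\<close> sees \<open>\<delta>\<close> of them. Fewer than \<open>\<delta>\<close> classes have more than
  one element, so \<open>x\<close> sees the only element \<open>y\<close> of some class. All neighbours of \<open>y\<close> are in \<open>S\<close>, and
  the at least \<open>\<delta>\<close> representatives next to \<open>x\<close> are outside \<open>S\<close>.
\<close>

lemma dense_edge_of_tight_set: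
  fixes c :: "'a \<Rightarrow> 'b"
  assumes deg: "\<And>v. v \<in> pverts G \<Longrightarrow> \<delta> \<le> card (nbh G v)"
    and \<delta>: "card (pverts G) + 4 \<le> 3 * \<delta>"
    and S: "S \<subseteq> pverts G" "\<delta> \<le> card S" "card S \<le> card (c ` (pverts G - S))"
    and resp: "\<And>u v. (u, v) \<in> parcs G \<Longrightarrow> u \<notin> S \<Longrightarrow> v \<notin> S \<Longrightarrow> c u = c v"
  shows "\<exists>x y. (x, y) \<in> parcs G \<and> 2 * \<delta> \<le> card (nbh G x \<union> nbh G y)"
proof -
  let ?W = "pverts G - S"
  define P where "P = (\<lambda>t. {u \<in> ?W. c u = c t})"
  have fin: "finite ?W" "finite S" using S(1) by (auto intro: finite_verts_subset)
  obtain T where T: "T \<subseteq> ?W" "inj_on c T" "card T = card (c ` ?W)"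
    and sumP: "(\<Sum>t\<in>T. card (P t)) = card ?W"
    unfolding P_def by (rule transversal_of_labelling[OF fin(1), of c])
  have finT: "finite T" using T(1) fin(1) by (rule finite_subset)
  have finP: "finite (P t)" for t using fin by (simp add: P_def)
  have n: "card ?W + card S = card (pverts G)"
    using S(1) by (rule card_verts_Diff)
  have P_self: "t \<in> P t" if "t \<in> T" for t using that T by (auto simp: P_def)
  have nbh_T: "nbh G t \<subseteq> S \<union> (P t - {t})" if "t \<in> T" for t
  proof
    fix u assume "u \<in> nbh G t"
    then have "(t, u) \<in> parcs G" "u \<in> pverts G" "u \<noteq> t"
      by (auto simp: nbh_def dest: wellformed' no_loops')
    then show "u \<in> S \<union> (P t - {t})" using resp[of t u] that T(1) by (auto simp: P_def)
  qed
  have part: "\<delta> + 1 \<le> card (nbh G t \<inter> S) + card (P t)" if "t \<in> T" for t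
  proof -
    have "\<delta> \<le> card (nbh G t)" using deg that T(1) by blast
    also have "\<dots> \<le> card ((nbh G t \<inter> S) \<union> (P t - {t}))"
      using nbh_T[OF that] finP by (intro card_mono) auto
    also have "\<dots> \<le> card (nbh G t \<inter> S) + card (P t - {t})" by (rule card_Un_le)
    finally show ?thesis using P_self[OF that] finP[of t] card_Suc_Diff1[of "P t" t] by simp
  qed
  have "card T * (\<delta> + 1) = (\<Sum>t\<in>T. \<delta> + 1)" by simp
  also have "\<dots> \<le> (\<Sum>t\<in>T. card (nbh G t \<inter> S) + card (P t))" by (rule sum_mono) (rule part)
  also have "\<dots> = (\<Sum>x\<in>S. card (nbh G x \<inter> T)) + card ?W"
    by (simp add: sum.distrib sumP sum_card_nbh_swap[OF finT fin(2)])
  finally have count: "card T * (\<delta> + 1) \<le> (\<Sum>x\<in>S. card (nbh G x \<inter> T)) + card ?W" .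
  have "\<exists>x\<in>S. \<delta> \<le> card (nbh G x \<inter> T)"
  proof (rule ccontr)
    assume "\<not> ?thesis"
    then have "card (nbh G x \<inter> T) \<le> \<delta> - 1" if "x \<in> S" for x using that by force
    then have "(\<Sum>x\<in>S. card (nbh G x \<inter> T)) \<le> card S * (\<delta> - 1)"
      using sum_bounded_above[of S "\<lambda>x. card (nbh G x \<inter> T)" "\<delta> - 1"] by simp
    moreover have "card S * (\<delta> + 1) \<le> card T * (\<delta> + 1)" 
      using S(3) T(3) by (intro mult_right_mono) auto
    moreover have "card S * (\<delta> + 1) = card S * (\<delta> - 1) + 2 * card S"
      using \<delta> by (cases \<delta>) auto
    ultimately have "2 * card S \<le> card ?W" using count by linarith
    then show False using n \<delta> S(2) by linarith
  qed
  then obtain x where x: "x \<in> S" "\<delta> \<le> card (nbh G x \<inter> T)" by blast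
  define B where "B = {t \<in> T. card (P t) \<noteq> 1}"
  have "card T + card B = (\<Sum>t\<in>T. 1 + (if card (P t) \<noteq> 1 then 1 else 0))"
    using finT by (simp only: sum.distrib) (simp add: B_def sum.If_cases Int_def)
  also have "\<dots> \<le> (\<Sum>t\<in>T. card (P t))"
  proof (rule sum_mono)
    fix t assume "t \<in> T"
    then have "card (P t) \<noteq> 0" using P_self finP by (metis card_0_eq empty_iff)
    then show "1 + (if card (P t) \<noteq> 1 then 1 else 0) \<le> card (P t)" by auto
  qed
  finally have "card B < \<delta>" using sumP n S(2,3) T(3) \<delta> by linarith
  have "\<not> nbh G x \<inter> T \<subseteq> B"
  proof
    assume "nbh G x \<inter> T \<subseteq> B"
    then have "card (nbh G x \<inter> T) \<le> card B" using finT by (intro card_mono) (auto simp: B_def)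
    then show False using x \<open>card B < \<delta>\<close> by linarith
  qed
  then obtain y where y: "y \<in> nbh G x" "y \<in> T" "card (P y) = 1" by (auto simp: B_def)
  then have "P y = {y}" using P_self by (metis card_1_singletonE singletonD)
  then have "nbh G y \<subseteq> S" using nbh_T[OF y(2)] by auto
  then have "card ((nbh G x \<inter> T) \<union> nbh G y) = card (nbh G x \<inter> T) + card (nbh G y)"
    using T by (intro card_Un_disjoint) auto
  moreover have "card ((nbh G x \<inter> T) \<union> nbh G y) \<le> card (nbh G x \<union> nbh G y)"
    by (intro card_mono) auto
  moreover have "\<delta> \<le> card (nbh G y)" using deg y nbh_subset by blast
  ultimately have "2 * \<delta> \<le> card (nbh G x \<union> nbh G y)" using x(2) by linarith
  then show ?thesis using y(1) by (auto simp: nbh_def)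
qed

text \<open>
  The union of the neighbourhoods stays within \<open>S\<close> and the classes of \<open>x\<close> and \<open>y\<close>; the at least
  \<open>|S| - 1\<close> other classes are nonempty.
\<close>

lemma splits_card_nbh_union:
  assumes "splits G x y S c"
  shows "card (nbh G x \<union> nbh G y) + card S \<le> card (pverts G) + 1"
proof -
  let ?W = "pverts G - S"
  define Q where "Q = {u \<in> ?W. c u = c x \<or> c u = c y}"
  have S: "S \<subseteq> pverts G" "card S < card (c ` ?W)" and xy: "x \<in> ?W" "y \<in> ?W" "c x \<noteq> c y"
    and resp: "\<And>u v. (u, v) \<in> parcs G \<Longrightarrow> u \<notin> S \<Longrightarrow> v \<notin> S \<Longrightarrow> c u = c v \<or> {u, v} = {x, y}"
    using assms by (auto simp: splits_def)
  have fin: "finite ?W" "finite S" "finite Q" using S(1) by (auto simp: Q_def intro: finite_verts_subset)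
  have n: "card ?W + card S = card (pverts G)"
    using S(1) by (rule card_verts_Diff)
  have "nbh G x \<union> nbh G y \<subseteq> S \<union> Q"
  proof
    fix u assume "u \<in> nbh G x \<union> nbh G y"
    then have u: "(x, u) \<in> parcs G \<or> (y, u) \<in> parcs G" "u \<in> pverts G"
      by (auto simp: nbh_def dest: wellformed')
    then show "u \<in> S \<union> Q"
      using resp[of x u] resp[of y u] xy by (auto simp: Q_def doubleton_eq_iff)
  qed
  then have "card (nbh G x \<union> nbh G y) \<le> card (S \<union> Q)" using fin by (intro card_mono) auto
  also have "\<dots> \<le> card S + card Q" by (rule card_Un_le)
  finally have 1: "card (nbh G x \<union> nbh G y) \<le> card S + card Q" .
  have "c ` ?W \<subseteq> insert (c x) (insert (c y) (c ` (?W - Q)))" by (auto simp: Q_def)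
  then have "card (c ` ?W) \<le> card (insert (c x) (insert (c y) (c ` (?W - Q))))"
    using fin by (intro card_mono) auto
  also have "\<dots> \<le> card (c ` (?W - Q)) + 2" using fin by (simp add: card_insert_if)
  also have "\<dots> \<le> card (?W - Q) + 2" using fin by (simp add: card_image_le)
  also have "card (?W - Q) = card ?W - card Q" using fin by (intro card_Diff_subset) (auto simp: Q_def)
  finally have "card (c ` ?W) \<le> card ?W - card Q + 2" .
  moreover have "card Q \<le> card ?W" using fin by (intro card_mono) (auto simp: Q_def)
  ultimately show ?thesis using 1 S(2) n by linarith
qed

text \<open>
  Representatives of the classes are independent, except that \<open>x\<close> and \<open>y\<close> may both be chosen;
  dropping \<open>y\<close> costs one element, and there is one class more than needed.
\<close>

lemma splits_independent_set:
  assumes "splits G x y S c"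
  obtains I where "I \<subseteq> pverts G" "card S \<le> card I" "\<And>u v. u \<in> I \<Longrightarrow> v \<in> I \<Longrightarrow> (u, v) \<notin> parcs G"
proof -
  let ?W = "pverts G - S"
  have "finite ?W" using pair_finite_verts by simp
  then obtain T where T: "T \<subseteq> ?W" "inj_on c T" "card T = card (c ` ?W)"
    by (rule transversal_of_labelling[of ?W c])
  have "card S \<le> card (T - {y})"
    using T(3) assms by (auto simp: splits_def card_Diff_singleton_if)
  moreover have "(u, v) \<notin> parcs G" if "u \<in> T - {y}" "v \<in> T - {y}" for u v
  proof
    assume uv: "(u, v) \<in> parcs G"
    have "c u = c v \<or> {u, v} = {x, y}"
      using assms uv that T(1) unfolding splits_def by blast
    then have "c u = c v" using that by (auto simp: doubleton_eq_iff)
    then have "u = v" using T(2) that by (auto dest: inj_onD)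
    then show False using uv no_loops' by blast
  qed
  ultimately show ?thesis using that[of "T - {y}"] T by auto
qed

text \<open>
  Put \<open>k = |S|\<close> and \<open>d = \<delta> - k\<close>. Each class has at least \<open>d + 1\<close> elements; only the classes
  represented by \<open>x\<close> or \<open>y\<close> may have one element less, since the bridge gives them a neighbour in another
  class. The \<open>k + 1\<close> or more classes have \<open>n - k\<close> elements, hence \<open>(k + 1)(d + 1) \<le> n - k + 2\<close>. With
  \<open>n \<le> 3(k + d) - 4\<close> this becomes \<open>(k - 2)(d - 1) + 1 \<le> 0\<close>, which is impossible for \<open>k \<ge> 2\<close> and \<open>d \<ge> 1\<close>.
\<close>

lemma splits_small_or_large:
  assumes deg: "\<And>v. v \<in> pverts G \<Longrightarrow> \<delta> \<le> card (nbh G v)"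
    and \<delta>: "card (pverts G) + 4 \<le> 3 * \<delta>"
    and sp: "splits G x y S c"
  shows "card S \<le> 1 \<or> \<delta> \<le> card S"
proof (rule ccontr)
  assume neg: "\<not> ?thesis"
  let ?W = "pverts G - S"
  define P where "P = (\<lambda>t. {u \<in> ?W. c u = c t})"
  have S: "S \<subseteq> pverts G" "card S < card (c ` ?W)"
    and resp: "\<And>u v. (u, v) \<in> parcs G \<Longrightarrow> u \<notin> S \<Longrightarrow> v \<notin> S \<Longrightarrow> c u = c v \<or> {u, v} = {x, y}"
    using sp by (auto simp: splits_def)
  have fin: "finite ?W" "finite S" using S(1) by (auto intro: finite_verts_subset)
  obtain T where T: "T \<subseteq> ?W" "inj_on c T" "card T = card (c ` ?W)"
    and sumP: "(\<Sum>t\<in>T. card (P t)) = card ?W"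
    unfolding P_def by (rule transversal_of_labelling[OF fin(1), of c])
  have finT: "finite T" using T(1) fin(1) by (rule finite_subset)
  have finP: "finite (P t)" for t using fin by (simp add: P_def)
  have n: "card ?W + card S = card (pverts G)"
    using S(1) by (rule card_verts_Diff)
  define d where "d = \<delta> - card S"
  have part: "d + 1 \<le> card (P t) + (if t \<in> {x, y} then 1 else 0)" if t: "t \<in> T" for t
  proof -
    \<comment> \<open>the neighbour of \<open>t\<close> along the bridge\<close>
    define E where "E = (if t = x then {y} else if t = y then {x} else {})"
    have "nbh G t \<subseteq> S \<union> (P t - {t}) \<union> E"
    proof
      fix u assume "u \<in> nbh G t"
      then have u: "(t, u) \<in> parcs G" "u \<in> pverts G" "u \<noteq> t"
        by (auto simp: nbh_def dest: wellformed' no_loops')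
      then show "u \<in> S \<union> (P t - {t}) \<union> E"
        using resp[of t u] t T by (auto simp: P_def E_def doubleton_eq_iff)
    qed
    then have "card (nbh G t) \<le> card (S \<union> (P t - {t}) \<union> E)"
      using fin finP by (intro card_mono) (auto simp: E_def)
    moreover have "\<delta> \<le> card (nbh G t)" using deg t T(1) by blast
    ultimately have "\<delta> \<le> card (S \<union> (P t - {t}) \<union> E)" by linarith
    also have "\<dots> \<le> card S + card (P t - {t}) + card E"
      by (meson card_Un_le add_right_mono order_trans)
    also have "card E = (if t \<in> {x, y} then 1 else 0)" by (simp add: E_def)
    finally have "\<delta> \<le> card S + card (P t - {t}) + (if t \<in> {x, y} then 1 else 0)" .
    moreover have "t \<in> P t" using t T by (auto simp: P_def)
    then have "card (P t) = card (P t - {t}) + 1"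
      using finP[of t] by (metis Suc_eq_plus1 card_Suc_Diff1)
    ultimately show ?thesis using neg by (simp add: d_def)
  qed
  have "card T * (d + 1) = (\<Sum>t\<in>T. d + 1)" by simp
  also have "\<dots> \<le> (\<Sum>t\<in>T. card (P t) + (if t \<in> {x, y} then 1 else 0))" by (rule sum_mono) (rule part)
  also have "\<dots> = card ?W + card (T \<inter> {x, y})"
    using finT by (simp add: sum.distrib sumP sum.If_cases Int_def)
  also have "card (T \<inter> {x, y}) \<le> card {x, y}" by (rule card_mono) auto
  also have "card {x, y} \<le> 2" by (simp add: card_insert_if)
  finally have "card T * (d + 1) \<le> card ?W + 2" by simp
  moreover have "(card S + 1) * (d + 1) \<le> card T * (d + 1)"
    using S(2) T(3) by (intro mult_right_mono) auto
  ultimately have "(card S + 1) * (d + 1) + card S + 2 \<le> 3 * \<delta>" using n \<delta> by linarith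
  \<comment> \<open>substituting \<open>k = a + 2\<close> and \<open>d = b + 1\<close> leaves \<open>ab + 1 \<le> 0\<close>\<close>
  moreover obtain a where "card S = a + 2" using neg by (metis add.commute le_Suc_ex not_less_eq_eq one_add_one plus_1_eq_Suc nat_le_linear)
  moreover obtain b where "d = b + 1" using neg unfolding d_def by (metis Suc_eq_plus1 Suc_diff_Suc not_le)
  moreover have "\<delta> = card S + d" using neg by (simp add: d_def)
  ultimately show False by (simp add: algebra_simps)
qed

section \<open>Two dense sides joined by a bridge\<close>

text \<open>
  At most one edge \<open>xy\<close> leaves \<open>A\<close> without ending in \<open>S\<close>, and \<open>S\<close> has at most one element. So the
  vertices of \<open>A\<close> other than \<open>x\<close> have all but at most one of their neighbours in \<open>A\<close>.
\<close>

definition side :: "'a set \<Rightarrow> 'a set \<Rightarrow> 'a \<Rightarrow> 'a \<Rightarrow> bool" where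
  "side S A x y \<longleftrightarrow> S \<union> A \<subseteq> pverts G \<and> card S \<le> 1 \<and> x \<in> A \<and>
     (\<forall>u\<in>A. nbh G u \<subseteq> S \<union> A \<union> (if u = x then {y} else {}))"

text \<open>
  The class of \<open>x\<close> is one side; all other classes together, one of which contains \<open>y\<close>, form the other.
\<close>

lemma splits_sides:
  assumes sp: "splits G x y S c" and "card S \<le> 1"
  obtains A B where "side S A x y" "side S B y x" "card A + card B + card S = card (pverts G)"
    "pverts G = S \<union> A \<union> B"
proof
  let ?W = "pverts G - S"
  let ?A = "{u \<in> ?W. c u = c x}" and ?B = "{u \<in> ?W. c u \<noteq> c x}"
  have resp: "\<And>u v. (u, v) \<in> parcs G \<Longrightarrow> u \<notin> S \<Longrightarrow> v \<notin> S \<Longrightarrow> c u = c v \<or> {u, v} = {x, y}"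
    and S: "S \<subseteq> pverts G"
    using sp by (auto simp: splits_def)
  have *: "v \<in> S \<or> v \<in> pverts G \<and> (c v = c u \<or> u = x \<and> v = y \<or> u = y \<and> v = x)"
    if "u \<in> ?W" "v \<in> nbh G u" for u v
    using that resp[of u v] by (auto simp: nbh_def doubleton_eq_iff dest: wellformed')
  have xy: "x \<in> ?A" "y \<in> ?B" using sp by (auto simp: splits_def)
  have "v \<in> S \<union> ?A \<union> (if u = x then {y} else {})" if "u \<in> ?A" "v \<in> nbh G u" for u v
    using *[of u v] that xy by auto
  then show "side S ?A x y" using S assms(2) xy(1) unfolding side_def by blast
  have "v \<in> S \<union> ?B \<union> (if u = y then {x} else {})" if "u \<in> ?B" "v \<in> nbh G u" for u v
    using *[of u v] that xy by auto
  then show "side S ?B y x" using S assms(2) xy(2) unfolding side_def by blast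
  show V: "pverts G = S \<union> ?A \<union> ?B" using S by auto
  have fin: "finite S" "finite ?A" "finite ?B" using S by (auto intro: finite_verts_subset)
  have "card (S \<union> ?A \<union> ?B) = card (S \<union> ?A) + card ?B" using fin by (intro card_Un_disjoint) auto
  moreover have "card (S \<union> ?A) = card S + card ?A" using fin by (intro card_Un_disjoint) auto
  ultimately show "card ?A + card ?B + card S = card (pverts G)" using V by simp
qed

text \<open>
  As \<open>\<delta> \<ge> 3\<close>, the vertex \<open>x\<close> has a neighbour \<open>u\<close> in \<open>A\<close>, and \<open>u\<close> has \<open>\<delta> - 1\<close> neighbours in \<open>A\<close>.
\<close>

lemma side_card:
  assumes deg: "\<And>v. v \<in> pverts G \<Longrightarrow> \<delta> \<le> card (nbh G v)" and "3 \<le> \<delta>"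
    and side: "side S A x y"
  shows "\<delta> \<le> card A"
proof -
  have A: "A \<subseteq> pverts G" "S \<subseteq> pverts G" "card S \<le> 1" "x \<in> A" using side by (auto simp: side_def)
  have fin: "finite A" "finite S" using A by (auto intro: finite_verts_subset)
  have "nbh G x \<inter> A \<noteq> {}"
  proof
    assume "nbh G x \<inter> A = {}"
    moreover have "nbh G x \<subseteq> S \<union> A \<union> (if x = x then {y} else {})"
      using side unfolding side_def by blast
    ultimately have "nbh G x \<subseteq> insert y S" by auto
    then have "card (nbh G x) \<le> card (insert y S)" using fin by (intro card_mono) auto
    also have "\<dots> \<le> 2" using fin A(3) by (simp add: card_insert_if)
    finally show False using deg[of x] A assms(2) by auto
  qed
  then obtain u where u: "u \<in> A" "u \<noteq> x" using not_in_nbh_self[of x] by (metis Int_iff ex_in_conv)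
  then have "nbh G u \<subseteq> S \<union> (A - {u})" using side by (auto simp: side_def split: if_splits)
  then have "card (nbh G u) \<le> card (S \<union> (A - {u}))" using fin by (intro card_mono) auto
  also have "\<dots> \<le> card S + card (A - {u})" by (rule card_Un_le)
  finally show ?thesis using deg[of u] u A fin card_Suc_Diff1[of A u] by auto
qed

text \<open>
  A vertex of \<open>I \<inter> A\<close> other than \<open>x\<close> has \<open>\<delta> - 1\<close> neighbours in \<open>A\<close>, all of them outside \<open>I\<close>. If \<open>x\<close> is
  the only element of \<open>I \<inter> A\<close>, the size of \<open>A\<close> suffices.
\<close>

lemma side_independent:
  assumes deg: "\<And>v. v \<in> pverts G \<Longrightarrow> \<delta> \<le> card (nbh G v)" and "3 \<le> \<delta>"
    and side: "side S A x y" and I: "\<And>u v. u \<in> I \<Longrightarrow> v \<in> I \<Longrightarrow> (u, v) \<notin> parcs G"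
  shows "card (I \<inter> A) + \<delta> \<le> card A + 1"
proof (cases "I \<inter> A \<subseteq> {x}")
  case True
  then have "card (I \<inter> A) \<le> card {x}" by (intro card_mono) auto
  then show ?thesis using side_card[OF deg \<open>3 \<le> \<delta>\<close> side] by simp
next
  case False
  then obtain u where u: "u \<in> I" "u \<in> A" "u \<noteq> x" by auto
  have A: "A \<subseteq> pverts G" "S \<subseteq> pverts G" "card S \<le> 1" using side by (auto simp: side_def)
  have fin: "finite A" "finite S" using A by (auto intro: finite_verts_subset)
  have "nbh G u \<subseteq> S \<union> (A - I)" using side u I[OF u(1)] by (auto simp: side_def nbh_def split: if_splits)
  then have "card (nbh G u) \<le> card (S \<union> (A - I))" using fin by (intro card_mono) auto
  also have "\<dots> \<le> card S + card (A - I)" by (rule card_Un_le)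
  finally have "\<delta> \<le> card (A - I) + 1" using deg[of u] u A by auto
  moreover have "card (A - I) + card (I \<inter> A) = card A"
    using fin by (metis Int_commute card_Diff_subset_Int card_mono finite_Int inf_le1 le_add_diff_inverse2)
  ultimately show ?thesis by linarith
qed

text \<open>
  Adjacent vertices \<open>u\<close> and \<open>w\<close> of \<open>A\<close> other than \<open>x\<close> have their at least \<open>2\<delta>\<close> neighbours, counted with
  multiplicity, among at most \<open>|A| + 1\<close> vertices.
\<close>

lemma side_edge_with_common_nbhs:
  assumes deg: "\<And>v. v \<in> pverts G \<Longrightarrow> \<delta> \<le> card (nbh G v)" and "3 \<le> \<delta>"
    and side: "side S A x y"
  obtains u w where "(u, w) \<in> parcs G" "2 * \<delta> \<le> card (nbh G u \<inter> nbh G w) + card A + 1"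
proof -
  have A: "A \<subseteq> pverts G" "S \<subseteq> pverts G" "card S \<le> 1" "x \<in> A" using side by (auto simp: side_def)
  have fin: "finite A" "finite S" using A by (auto intro: finite_verts_subset)
  have nbh: "nbh G u \<subseteq> S \<union> A" if "u \<in> A - {x}" for u
    using that side by (auto simp: side_def split: if_splits)
  have "\<not> A \<subseteq> {x}"
  proof
    assume "A \<subseteq> {x}"
    then have "card A \<le> card {x}" by (intro card_mono) auto
    then show False using side_card[OF deg \<open>3 \<le> \<delta>\<close> side] \<open>3 \<le> \<delta>\<close> by simp
  qed
  then obtain u where u: "u \<in> A - {x}" by auto
  have "\<not> nbh G u \<subseteq> insert x S"
  proof
    assume "nbh G u \<subseteq> insert x S"
    then have "card (nbh G u) \<le> card (insert x S)" using fin by (intro card_mono) auto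
    also have "\<dots> \<le> 2" using fin A(3) by (simp add: card_insert_if)
    finally show False using deg[of u] u A assms(2) by auto
  qed
  then obtain w where w: "w \<in> nbh G u" "w \<in> A - {x}" using nbh[OF u] by auto
  have "card (nbh G u \<union> nbh G w) \<le> card (S \<union> A)"
    using nbh u w fin by (intro card_mono) auto
  also have "\<dots> \<le> card S + card A" by (rule card_Un_le)
  finally have "card (nbh G u \<union> nbh G w) \<le> card A + 1" using A by linarith
  moreover have "card (nbh G u) + card (nbh G w) = card (nbh G u \<union> nbh G w) + card (nbh G u \<inter> nbh G w)"
    by (intro card_Un_Int) auto
  moreover have "\<delta> \<le> card (nbh G u)" "\<delta> \<le> card (nbh G w)" using deg u w A by auto
  ultimately have "2 * \<delta> \<le> card (nbh G u \<inter> nbh G w) + card A + 1" by linarith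
  then show ?thesis using that w by (auto simp: nbh_def)
qed

text \<open>A common neighbour outside \<open>S\<close> would have the labels of both \<open>x\<close> and \<open>y\<close>.\<close>

lemma splits_common_nbhs:
  assumes "splits G x y S c"
  shows "nbh G x \<inter> nbh G y \<subseteq> S"
proof
  fix z assume "z \<in> nbh G x \<inter> nbh G y"
  then have "(x, z) \<in> parcs G" "(y, z) \<in> parcs G" "z \<noteq> x" "z \<noteq> y"
    by (auto simp: nbh_def dest: no_loops')
  then show "z \<in> S" using assms unfolding splits_def by (metis DiffE doubleton_eq_iff)
qed

section \<open>The degree bound\<close>

text \<open>
  The two cases are whether some edge has a set \<open>S\<close> with at most one element. In the first case such
  an edge yields two sides, which rule out large sets \<open>S\<close> for all edges and then give an
  edge whose ends have too many common neighbours. In the second case all sets are large, and the edge of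
  \<open>dense_edge_of_tight_set\<close> has too many vertices around it.
\<close>

lemma no_dense_graph_of_bridges:
  assumes deg: "\<And>v. v \<in> pverts G \<Longrightarrow> \<delta> \<le> card (nbh G v)"
    and \<delta>: "card (pverts G) + 4 \<le> 3 * \<delta>"
    and split: "\<And>x y. (x, y) \<in> parcs G \<Longrightarrow> \<exists>S (c :: 'a \<Rightarrow> 'b). splits G x y S c"
  shows "pverts G = {}"
proof (rule ccontr)
  assume "pverts G \<noteq> {}"
  then obtain v where v: "v \<in> pverts G" by auto
  have "card (nbh G v) \<le> card (pverts G - {v})"
    using nbh_subset pair_finite_verts by (intro card_mono) auto
  then have "\<delta> + 1 \<le> card (pverts G)"
    using deg[OF v] v pair_finite_verts card_Suc_Diff1[of "pverts G" v] by auto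
  then have "3 \<le> \<delta>" using \<delta> by linarith
  then have "nbh G v \<noteq> {}" using deg[OF v] by auto
  then obtain x0 y0 where e0: "(x0, y0) \<in> parcs G" by (auto simp: nbh_def)
  show False
  proof (cases "\<exists>x y S (c :: 'a \<Rightarrow> 'b). splits G x y S c \<and> card S \<le> 1")
    case True
    then obtain x y S and c :: "'a \<Rightarrow> 'b" where "splits G x y S c" "card S \<le> 1" by blast
    then obtain A B where sides: "side S A x y" "side S B y x"
      and n: "card A + card B + card S = card (pverts G)" and V: "pverts G = S \<union> A \<union> B"
      by (rule splits_sides)
    have finS: "finite S" using V pair_finite_verts by (metis finite_Un)
    have small: "card S' \<le> 1" if sp': "splits G x' y' S' c'" for x' y' S' and c' :: "'a \<Rightarrow> 'b"
    proof (rule ccontr)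
      assume "\<not> card S' \<le> 1"
      then have "\<delta> \<le> card S'" using splits_small_or_large[OF deg \<delta> sp'] by blast
      moreover obtain I where I: "I \<subseteq> pverts G" "card S' \<le> card I"
        "\<And>u v. u \<in> I \<Longrightarrow> v \<in> I \<Longrightarrow> (u, v) \<notin> parcs G"
        using splits_independent_set[OF sp'] by blast
      have "I = (I \<inter> S) \<union> (I \<inter> A) \<union> (I \<inter> B)" using I(1) V by auto
      then have "card I \<le> card (I \<inter> S) + card (I \<inter> A) + card (I \<inter> B)"
        by (metis card_Un_le add_right_mono order_trans)
      moreover have "card (I \<inter> S) \<le> card S" using finS by (intro card_mono) auto
      moreover have "card (I \<inter> A) + \<delta> \<le> card A + 1" "card (I \<inter> B) + \<delta> \<le> card B + 1"
        using side_independent[OF deg \<open>3 \<le> \<delta>\<close> _ I(3)] sides by blast+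
      ultimately show False using I(2) n \<delta> by linarith
    qed
    \<comment> \<open>the smaller side\<close>
    have "\<exists>D a b. side S D a b \<and> 2 * card D \<le> card (pverts G)"
    proof (cases "card A \<le> card B")
      case True then show ?thesis using sides(1) n by (intro exI[of _ A] exI conjI) auto
    next
      case False then show ?thesis using sides(2) n by (intro exI[of _ B] exI conjI) auto
    qed
    then obtain D a b where D: "side S D a b" "2 * card D \<le> card (pverts G)" by blast
    obtain u w where uw: "(u, w) \<in> parcs G" "2 * \<delta> \<le> card (nbh G u \<inter> nbh G w) + card D + 1"
      using side_edge_with_common_nbhs[OF deg \<open>3 \<le> \<delta>\<close> D(1)] by blast
    obtain S' and c' :: "'a \<Rightarrow> 'b" where sp': "splits G u w S' c'" using split[OF uw(1)] by blast
    have "finite S'" using sp' by (auto simp: splits_def intro: finite_verts_subset)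
    then have "card (nbh G u \<inter> nbh G w) \<le> card S'"
      using splits_common_nbhs[OF sp'] by (intro card_mono)
    then show False using small[OF sp'] uw(2) D(2) \<delta> by linarith
  next
    case False
    then have large: "\<delta> \<le> card S" if "splits G x y S c" for x y S and c :: "'a \<Rightarrow> 'b"
      using splits_small_or_large[OF deg \<delta> that] that by blast
    obtain S and c :: "'a \<Rightarrow> 'b" where sp: "splits G x0 y0 S c" using split[OF e0] by blast
    \<comment> \<open>Merging the classes of the ends makes the labelling respect the bridge as well, at the cost
      of one label.\<close>
    define c' where "c' = (\<lambda>v. if c v = c y0 then c x0 else c v)"
    have fin: "finite (pverts G - S)" using pair_finite_verts by simp
    have "card (c ` (pverts G - S)) \<le> card (insert (c y0) (c' ` (pverts G - S)))"
      using fin by (intro card_mono) (auto simp: c'_def)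
    also have "\<dots> \<le> card (c' ` (pverts G - S)) + 1" using fin by (simp add: card_insert_if)
    finally have "card S \<le> card (c' ` (pverts G - S))" using sp by (simp add: splits_def)
    moreover have "c' u = c' v" if "(u, v) \<in> parcs G" "u \<notin> S" "v \<notin> S" for u v
    proof -
      have "c u = c v \<or> {u, v} = {x0, y0}" using sp that by (simp add: splits_def)
      then show ?thesis by (auto simp: c'_def doubleton_eq_iff)
    qed
    moreover have "S \<subseteq> pverts G" using sp by (simp add: splits_def)
    ultimately obtain x y where xy: "(x, y) \<in> parcs G" "2 * \<delta> \<le> card (nbh G x \<union> nbh G y)"
      using dense_edge_of_tight_set[OF deg \<delta> _ large[OF sp], of c'] by blast
    obtain S' and c'' :: "'a \<Rightarrow> 'b" where sp': "splits G x y S' c''" using split[OF xy(1)] by blast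
    show False using splits_card_nbh_union[OF sp'] large[OF sp'] xy(2) \<delta> by linarith
  qed
qed

lemma out_degree_eq_card_nbh: "out_degree (with_proj G) v = card (nbh G v)"
proof -
  have "out_arcs (with_proj G) v = Pair v ` nbh G v" by (auto simp: out_arcs_def nbh_def)
  then show ?thesis by (simp add: out_degree_def card_image inj_on_def)
qed

end

theorem theorem1p7:
  fixes G :: "'a pair_pre_digraph" and n :: nat
  assumes "pair_graph G"
    and "card (pverts G) = n"
    and "minimally_tough 1 G"
  shows "\<exists>v \<in> pverts G. real (out_degree (with_proj G) v) \<le> real n / 3 + 1"
proof (rule ccontr)
  assume neg: "\<not> ?thesis"
  interpret pair_graph G by fact
  \<comment> \<open>the least integer above \<open>n / 3 + 1\<close>\<close>
  define \<delta> where "\<delta> = (n + 6) div 3"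
  have deg: "\<delta> \<le> card (nbh G v)" if "v \<in> pverts G" for v
  proof -
    have "real n / 3 + 1 < real (card (nbh G v))"
      using neg that by (auto simp: out_degree_eq_card_nbh not_le)
    then have "n + 3 < 3 * card (nbh G v)" by linarith
    then show ?thesis unfolding \<delta>_def by linarith
  qed
  have "card (pverts G) + 4 \<le> 3 * \<delta>" unfolding \<delta>_def assms(2) by linarith
  with deg have "pverts G = {}"
    using minimally_1_tough_splits[OF assms(3)] by (rule no_dense_graph_of_bridges)
  then have "parcs G = {}" by (auto dest: arc_fst_in_verts)
  then have "complete_digraph 0 (with_proj G)"
    using \<open>pverts G = {}\<close> pair_graphD_graph by (simp add: complete_digraph_def)
  then have "toughness G = \<infinity>" by (auto simp: toughness_def)
  then show False using assms(3) by (simp add: minimally_tough_def)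
qed

end
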